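(* Let $s \geq 0$. There exists a constant $c_s > 0$ (depending only on $s$) such that for every integer $n \geq 2$ and every set of $n$ great circles on $\mathbb{S}^2$, with $1/n$-neighborhoods $C_1, \dots, C_n$, $$ \sum_{\substack{i,j=1 \\ i \neq j}}^{n} |C_i \cap C_j|^s \;\geq\; c_s \begin{cases} n^{2-2s} & \text{if } 0 \leq s < 2, \\ n^{-2} \log n & \text{if } s = 2, \\ n^{1-3s/2} & \text{if } s > 2. \end{cases}$$
   Context: $\mathbb{S}^2$ is the unit sphere in $\mathbb{R}^3$. A great circle is the intersection of $\mathbb{S}^2$ with a plane through the origin. The $1/n$-neighborhood of a great circle is the set of points of $\mathbb{S}^2$ at geodesic distance at most $1/n$ from it. $|\cdot|$ denotes surface area on $\mathbb{S}^2$ (total area $4\pi$). The sum runs over ordered pairs $(i,j)$ with $i\neq j$. *)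

theory Defs
  imports "HOL-Analysis.Analysis"
begin

definition great_circle :: "(real ^ 3) set \<Rightarrow> bool" where
  "great_circle \<Gamma> \<longleftrightarrow> (\<exists>P. subspace P \<and> dim P = 2 \<and> \<Gamma> = sphere 0 1 \<inter> P)"

text \<open>Only meaningful for points of the unit sphere: the geodesic distance is the angle
  between the two unit vectors.\<close>

definition geodesic_dist :: "real ^ 3 \<Rightarrow> real ^ 3 \<Rightarrow> real" where
  "geodesic_dist x y = arccos (x \<bullet> y)"

definition sphere_neighborhood :: "real \<Rightarrow> (real ^ 3) set \<Rightarrow> (real ^ 3) set" where
  "sphere_neighborhood \<delta> \<Gamma> = {x \<in> sphere 0 1. (INF y\<in>\<Gamma>. geodesic_dist x y) \<le> \<delta>}"

text \<open>Surface area on the unit sphere, as the surface measure of polar coordinates: in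
  dimension 3 the solid cone over \<open>A\<close>, truncated at radius 1, has volume
  \<open>\<integral>\<^sub>0\<^sup>1 r\<^sup>2 \<bar>A\<bar> dr = \<bar>A\<bar> / 3\<close>.\<close>

definition surface_area :: "(real ^ 3) set \<Rightarrow> real" where
  "surface_area A = 3 * measure lebesgue {r *\<^sub>R x | r x. r \<in> {0..1} \<and> x \<in> A}"

lemma surface_area_unit_sphere: "surface_area (sphere 0 1) = 4 * pi"
proof -
  have "{r *\<^sub>R x | r x. r \<in> {0..1} \<and> x \<in> sphere 0 1} = cball (0 :: real ^ 3) 1"
  proof (intro set_eqI iffI)
    fix z :: "real ^ 3"
    assume z: "z \<in> cball 0 1"
    show "z \<in> {r *\<^sub>R x | r x. r \<in> {0..1} \<and> x \<in> sphere 0 1}"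
    proof (cases "z = 0")
      case True
      obtain e :: "real ^ 3" where "norm e = 1"
        using vector_choose_size[of 1] by auto
      with True show ?thesis
        by (auto intro!: exI[of _ "0::real"] exI[of _ e])
    next
      case False
      with z show ?thesis
        by (auto intro!: exI[of _ "norm z"] exI[of _ "z /\<^sub>R norm z"])
    qed
  qed auto
  moreover have "measure lebesgue (cball (0 :: real ^ 3) 1) = 4 / 3 * pi"
    by (simp add: content_cball unit_ball_vol_3)
  ultimately show ?thesis
    by (simp add: surface_area_def)
qed

end

(*
  Two strips of width 1/n whose normals u, v are at distance d contain, near the points where
  the circles cross, a patch of area at least a constant times n^-2 / max d (1/n).  It remains
  to bound a Riesz-type energy of n points on a sphere from below.  For s < 2 the bound
  n^-2 on each area suffices.  In general, the sphere is covered by O(m^2) cells of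
  diameter O(1/m), so for m^2 at most a small multiple of n, Cauchy-Schwarz gives at least a
  constant times n^2/m^2 ordered pairs of normals at distance O(1/m).  The single scale
  m ~ sqrt n yields the case s > 2, and for s = 2 each of the ~ log n dyadic scales
  m = 2^k contributes equally.
*)
theory Submission
  imports Defs
begin

section \<open>Counting close pairs by the pigeonhole principle\<close>

text \<open>Cauchy-Schwarz over the fibres of \<open>f\<close>: their sizes add up to
  \<open>card I\<close>, and the squares of their sizes count the ordered pairs with equal value.
  The summand \<open>card I\<close> on the right is the diagonal.\<close>

lemma card_le_card_collisions:
  fixes f :: "'a \<Rightarrow> 'b"
  assumes "finite I" "finite K" "f ` I \<subseteq> K"
  shows "real (card I)^2
    \<le> real (card K) * (real (card {(i,j). i \<in> I \<and> j \<in> I \<and> i \<noteq> j \<and> f i = f j}) + real (card I))"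
proof -
  define F where "F k = {i\<in>I. f i = k}" for k
  define N where "N = {(i,j). i \<in> I \<and> j \<in> I \<and> i \<noteq> j \<and> f i = f j}"
  have finF: "finite (F k)" for k using assms by (auto simp: F_def)
  have finN: "finite N"
    by (rule finite_subset[of _ "I \<times> I"]) (use assms in \<open>auto simp: N_def\<close>)
  have "(\<Union>k\<in>K. F k) = I" using assms by (auto simp: F_def)
  moreover have "card (\<Union>k\<in>K. F k) = (\<Sum>k\<in>K. card (F k))"
    by (rule card_UN_disjoint) (use assms finF in \<open>auto simp: F_def\<close>)
  ultimately have cI: "card I = (\<Sum>k\<in>K. card (F k))" by simp
  \<comment> \<open>Off-diagonal collisions and the diagonal together make up the squares of the
    fibres.\<close>
  have eq: "N \<union> Id_on I = (\<Union>k\<in>K. F k \<times> F k)"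
    using assms by (auto simp: F_def N_def Id_on_def)
  have "card (\<Union>k\<in>K. F k \<times> F k) = (\<Sum>k\<in>K. card (F k \<times> F k))"
    by (rule card_UN_disjoint) (use assms finF in \<open>auto simp: F_def\<close>)
  moreover have "card (N \<union> Id_on I) = card N + card (Id_on I)"
  proof (rule card_Un_disjoint)
    show "finite (Id_on I)" by (rule finite_subset[of _ "I \<times> I"]) (use assms in auto)
  qed (use finN in \<open>auto simp: N_def\<close>)
  moreover have "card (Id_on I) = card I"
    unfolding Id_on_def by (subst UNION_singleton_eq_range) (simp add: card_image inj_on_def)
  ultimately have cN: "card N + card I = (\<Sum>k\<in>K. card (F k)^2)"
    using eq by (simp add: card_cartesian_product power2_eq_square)
  have "real (card I)^2 = (\<Sum>k\<in>K. 1 * real (card (F k)))^2" by (simp add: cI)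
  also have "\<dots> \<le> (\<Sum>k\<in>K. 1^2) * (\<Sum>k\<in>K. real (card (F k))^2)"
    by (rule Cauchy_Schwarz_ineq_sum)
  also have "(\<Sum>k\<in>K. real (card (F k))^2) = card N + card I"
    unfolding of_nat_add [symmetric] cN by simp
  finally show ?thesis by (simp add: N_def)
qed

text \<open>Normals are scaled to lie on the surface of the cube rather than on the unit sphere, so that
  cutting the coordinates into intervals of length \<open>1/m\<close> gives only \<open>O(m\<^sup>2)\<close> cells.\<close>

definition normalized_normal :: "real^3 \<Rightarrow> bool" where
  "normalized_normal w \<longleftrightarrow> (\<exists>k. w $ k = 1) \<and> (\<forall>k. \<bar>w $ k\<bar> \<le> 1)"

text \<open>The cells are the values of the coordinatewise floor of \<open>m * w i\<close>. Sharing
  a cell makes each coordinate differ by at most \<open>1 / m\<close>, and comparison with the l1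
  norm gives the radius \<open>3 / m\<close>. The factor 27 is 3 faces times
  \<open>(3 * m)^2\<close>, from \<open>2 * m + 1 \<le> 3 * m\<close>.\<close>

lemma card_close_normals:
  fixes w :: "'a \<Rightarrow> real^3" and m :: nat
  assumes I: "finite I" and m: "m \<ge> 1" and w: "\<And>i. i \<in> I \<Longrightarrow> normalized_normal (w i)"
  shows "real (card I)^2
    \<le> 27 * real m^2 *
      (real (card {(i,j). i \<in> I \<and> j \<in> I \<and> i \<noteq> j \<and> norm (w i - w j) \<le> 3 / m}) + real (card I))"
proof -
  define f where "f i = (\<lfloor>m * w i $ 1\<rfloor>, \<lfloor>m * w i $ 2\<rfloor>, \<lfloor>m * w i $ 3\<rfloor>)" for i
  define J where "J = {- int m .. int m}"
  \<comment> \<open>Three faces of the cube suffice, not six: some coordinate is 1, not merely of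
    absolute value 1, so its floor is exactly \<open>m\<close>.\<close>
  define K where "K = {int m} \<times> J \<times> J \<union> J \<times> {int m} \<times> J \<union> J \<times> J \<times> {int m}"
  have fJ: "\<lfloor>m * w i $ k\<rfloor> \<in> J" if "i \<in> I" for i k
  proof -
    have "\<bar>w i $ k\<bar> \<le> 1" using w[OF that] by (auto simp: normalized_normal_def)
    then have "\<bar>m * w i $ k\<bar> \<le> m"
      by (simp add: abs_mult mult_left_le)
    then have "- real m \<le> m * w i $ k" "m * w i $ k \<le> m" by linarith+
    then show ?thesis unfolding J_def by (simp add: le_floor_iff floor_le_iff)
  qed
  have fK: "f ` I \<subseteq> K"
  proof (rule image_subsetI)
    fix i assume i: "i \<in> I"
    then obtain k where "w i $ k = 1" using w by (auto simp: normalized_normal_def)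
    then have "\<lfloor>m * w i $ k\<rfloor> = int m" by simp
    then show "f i \<in> K"
      using fJ[OF i] exhaust_3[of k] unfolding f_def K_def by auto
  qed
  have "card K \<le> card ({int m} \<times> J \<times> J) + card (J \<times> {int m} \<times> J) + card (J \<times> J \<times> {int m})"
    unfolding K_def by (meson card_Un_le add_right_mono order_trans)
  also have "\<dots> = 3 * (2*m+1)^2"
    by (simp add: card_cartesian_product J_def power2_eq_square nat_add_distrib nat_mult_distrib algebra_simps)
  also have "\<dots> \<le> 3 * (3*m)^2"
    using m by (intro mult_left_mono power_mono) auto
  finally have cK: "card K \<le> 27 * m^2" by (simp add: power_mult_distrib)
  have finK: "finite K" by (auto simp: K_def J_def)
  have sub: "{(i,j). i \<in> I \<and> j \<in> I \<and> i \<noteq> j \<and> f i = f j}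
      \<subseteq> {(i,j). i \<in> I \<and> j \<in> I \<and> i \<noteq> j \<and> norm (w i - w j) \<le> 3 / m}"
  proof safe
    fix i j assume eq: "f i = f j"
    have fl: "\<lfloor>m * w i $ k\<rfloor> = \<lfloor>m * w j $ k\<rfloor>" for k
      using eq exhaust_3[of k] by (auto simp: f_def)
    have "\<bar>(w i - w j) $ k\<bar> \<le> 1 / m" for k
    proof -
      have "\<bar>m * w i $ k - m * w j $ k\<bar> \<le> 1" using fl[of k] by linarith
      then have "m * \<bar>w i $ k - w j $ k\<bar> \<le> 1"
        by (metis abs_mult abs_of_nat right_diff_distrib)
      then show ?thesis using m by (simp add: field_simps)
    qed
    then have "(\<Sum>k\<in>UNIV. \<bar>(w i - w j) $ k\<bar>) \<le> (\<Sum>k\<in>(UNIV::3 set). 1 / m)"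
      by (rule sum_mono)
    then show "norm (w i - w j) \<le> 3 / m"
      using norm_le_l1_cart[of "w i - w j"] by simp
  qed
  have "finite {(i,j). i \<in> I \<and> j \<in> I \<and> i \<noteq> j \<and> norm (w i - w j) \<le> 3 / m}"
    by (rule finite_subset[of _ "I \<times> I"]) (use I in auto)
  from card_mono[OF this sub] have
    le: "card {(i,j). i \<in> I \<and> j \<in> I \<and> i \<noteq> j \<and> f i = f j}
     \<le> card {(i,j). i \<in> I \<and> j \<in> I \<and> i \<noteq> j \<and> norm (w i - w j) \<le> 3 / m}" .
  have "real (card I)^2
    \<le> real (card K) * (real (card {(i,j). i \<in> I \<and> j \<in> I \<and> i \<noteq> j \<and> f i = f j}) + real (card I))"
    by (rule card_le_card_collisions[OF I finK fK])
  also have "\<dots> \<le> real (27 * m^2) *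
      (real (card {(i,j). i \<in> I \<and> j \<in> I \<and> i \<noteq> j \<and> norm (w i - w j) \<le> 3 / m}) + real (card I))"
    by (intro mult_mono) (use cK le in \<open>auto simp del: of_nat_mult of_nat_power\<close>)
  finally show ?thesis by simp
qed

section \<open>Normals of great circles\<close>

text \<open>Any normal of the plane is divided by its entry of largest absolute value, sign
  included; this entry becomes 1 and no other exceeds it in absolute value.\<close>

lemma great_circle_normal:
  assumes "great_circle \<Gamma>"
  obtains w where "normalized_normal w" "\<Gamma> = sphere 0 1 \<inter> {x. w \<bullet> x = 0}"
proof -
  obtain P where P: "subspace P" "dim P = 2" "\<Gamma> = sphere 0 1 \<inter> P"
    using assms by (auto simp: great_circle_def)
  obtain a where a: "a \<noteq> 0" "span P = {x. a \<bullet> x = 0}"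
    using lowdim_eq_hyperplane[of P] P(2) by auto
  have "Max (range (\<lambda>l. \<bar>a $ l\<bar>)) \<in> range (\<lambda>l. \<bar>a $ l\<bar>)" by (rule Max_in) auto
  then obtain k where "Max (range (\<lambda>l. \<bar>a $ l\<bar>)) = \<bar>a $ k\<bar>" by blast
  then have k: "\<bar>a $ l\<bar> \<le> \<bar>a $ k\<bar>" for l
    using Max_ge[of "range (\<lambda>l. \<bar>a $ l\<bar>)" "\<bar>a $ l\<bar>"] by simp
  have k0: "a $ k \<noteq> 0"
    using k a(1) by (metis abs_le_zero_iff abs_zero vec_eq_iff zero_index)
  define w where "w = a /\<^sub>R (a $ k)"
  have "normalized_normal w"
    unfolding normalized_normal_def w_def
  proof (intro conjI allI exI[of _ k])
    show "\<bar>(a /\<^sub>R (a $ k)) $ l\<bar> \<le> 1" for l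
      using k[of l] k0 by (simp add: abs_mult field_simps)
  qed (use k0 in simp)
  moreover have "P = {x. w \<bullet> x = 0}"
    using a(2) span_eq_iff[THEN iffD2, OF P(1)] k0 by (simp add: w_def)
  ultimately show thesis using that P(3) by blast
qed

lemma norm_ge_1_if_normalized_normal:
  assumes "normalized_normal w"
  shows "norm w \<ge> 1"
proof -
  obtain k where "w $ k = 1" using assms by (auto simp: normalized_normal_def)
  then show ?thesis using component_le_norm_cart[of w k] by simp
qed

text \<open>With norms \<open>p\<close>, \<open>q\<close> and cosine \<open>t\<close>, the
  difference of the squared sides is \<open>(p - q)^2 + 2 * (p * q - 1) * (1 - t)\<close>, which is
  nonnegative. This carries distances between normals on the cube over to unit normals.\<close>

lemma norm_sgn_diff_le:
  fixes v w :: "'a::real_inner"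
  assumes "norm v \<ge> 1" "norm w \<ge> 1"
  shows "norm (sgn v - sgn w) \<le> norm (v - w)"
proof -
  define p where "p = norm v"
  define q where "q = norm w"
  define t where "t = sgn v \<bullet> sgn w"
  have pq: "p \<ge> 1" "q \<ge> 1" using assms by (auto simp: p_def q_def)
  have "v \<noteq> 0" "w \<noteq> 0" using assms by auto
  then have v: "p *\<^sub>R sgn v = v" "q *\<^sub>R sgn w = w"
    by (simp_all add: p_def q_def sgn_div_norm)
  have n: "sgn v \<bullet> sgn v = 1" "sgn w \<bullet> sgn w = 1"
    using assms by (auto simp: norm_eq_1 [symmetric] norm_sgn)
  have t1: "t \<le> 1" using norm_cauchy_schwarz[of "sgn v" "sgn w"] n
    by (simp add: t_def norm_eq_1 [symmetric])
  have "(norm (sgn v - sgn w))\<^sup>2 = 2 - 2 * t"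
    by (simp add: power2_norm_eq_inner inner_diff inner_commute n t_def)
  also have "\<dots> \<le> p\<^sup>2 + q\<^sup>2 - 2 * p * q * t"
  proof -
    have "1 * 1 \<le> p * q" using pq by (intro mult_mono) auto
    then have "(2 * p * q - 2) * (1 - t) \<ge> 0" using t1 by simp
    moreover have "(p - q)\<^sup>2 \<ge> 0" by simp
    ultimately show ?thesis by (simp add: power2_eq_square algebra_simps)
  qed
  also have "\<dots> = (norm (p *\<^sub>R sgn v - q *\<^sub>R sgn w))\<^sup>2"
    by (simp only: power2_norm_eq_inner inner_diff inner_scaleR_left inner_scaleR_right n t_def inner_commute[of "sgn w" "sgn v"])
       (simp add: power2_eq_square algebra_simps n)
  also have "\<dots> = (norm (v - w))\<^sup>2" by (simp only: v)
  finally show ?thesis by (rule power2_le_imp_le) simp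
qed

section \<open>Neighborhoods of great circles as bands\<close>

text \<open>The point of the circle nearest to \<open>x\<close> lies in the direction of the
  projection \<open>p\<close> of \<open>x\<close> to the plane, at angle
  \<open>arccos (norm p)\<close>. Since \<open>norm p\<close> and the height
  \<open>u \<bullet> x\<close> have squares adding up to 1, the angle is at most
  \<open>\<delta>\<close> iff the height is at most \<open>sin \<delta>\<close> in absolute
  value.\<close>

lemma sphere_neighborhood_eq_band:
  fixes u :: "real^3"
  assumes u: "norm u = 1" and \<delta>: "0 \<le> \<delta>" "\<delta> < pi / 2"
  shows "sphere_neighborhood \<delta> (sphere 0 1 \<inter> {x. u \<bullet> x = 0}) = {x \<in> sphere 0 1. \<bar>u \<bullet> x\<bar> \<le> sin \<delta>}"
proof -
  let ?G = "sphere 0 1 \<inter> {x. u \<bullet> x = 0}"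
  have uu: "u \<bullet> u = 1" using u by (simp add: norm_eq_1)
  have "(INF y\<in>?G. geodesic_dist x y) \<le> \<delta> \<longleftrightarrow> \<bar>u \<bullet> x\<bar> \<le> sin \<delta>" if x: "norm x = 1" for x
  proof -
    define t where "t = u \<bullet> x"
    define p where "p = x - t *\<^sub>R u"
    have xx: "x \<bullet> x = 1" using x by (simp add: norm_eq_1)
    have up: "u \<bullet> p = 0" by (simp add: p_def inner_diff uu t_def)
    have np: "(norm p)\<^sup>2 = 1 - t\<^sup>2"
      unfolding power2_norm_eq_inner
      by (simp add: p_def inner_diff uu xx t_def inner_commute power2_eq_square algebra_simps)
    have np1: "norm p \<le> 1"
      by (rule power2_le_imp_le) (auto simp: np)
    have xp: "x \<bullet> y = p \<bullet> y" if "y \<in> ?G" for y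
      using that by (simp add: p_def inner_diff)
    have ge: "arccos (norm p) \<le> geodesic_dist x y" if "y \<in> ?G" for y
      unfolding geodesic_dist_def xp[OF that]
    proof (rule arccos_le_arccos)
      show "p \<bullet> y \<le> norm p" using norm_cauchy_schwarz[of p y] that by simp
      show "-1 \<le> p \<bullet> y" using Cauchy_Schwarz_ineq2[of p y] np1 that by simp
    qed (use np1 in simp_all)
    \<comment> \<open>The infimum is attained: at the normalized projection, or at every point of
      the circle if \<open>x\<close> is one of the poles \<open>u\<close> and
      \<open>- u\<close>.\<close>
    have "\<exists>y\<in>?G. p \<bullet> y = norm p"
    proof (cases "p = 0")
      case True
      obtain y where "y \<noteq> 0" "orthogonal u y"
        using orthogonal_to_vector_exists[of u] by auto
      then show ?thesis using True
        by (intro bexI[of _ "sgn y"]) (auto simp: orthogonal_def norm_sgn sgn_div_norm)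
    next
      case False
      then show ?thesis using up
        by (intro bexI[of _ "sgn p"])
           (auto simp: norm_sgn sgn_div_norm dot_square_norm power2_eq_square)
    qed
    then obtain y where y: "y \<in> ?G" "p \<bullet> y = norm p" by blast
    have "geodesic_dist x y = arccos (norm p)"
      using xp[OF y(1)] y(2) by (simp add: geodesic_dist_def)
    then have "(INF y\<in>?G. geodesic_dist x y) = arccos (norm p)"
      by (intro cInf_eq_minimum) (use y(1) ge in \<open>force+\<close>)
    then have "(INF y\<in>?G. geodesic_dist x y) \<le> \<delta> \<longleftrightarrow> arccos (norm p) \<le> arccos (cos \<delta>)"
      using \<delta> by (simp add: arccos_cos)
    also have "\<dots> \<longleftrightarrow> cos \<delta> \<le> norm p"
      by (rule arccos_le_mono) (use np1 in \<open>auto simp: abs_cos_le_one\<close>)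
    also have "\<dots> \<longleftrightarrow> (cos \<delta>)\<^sup>2 \<le> (norm p)\<^sup>2"
      using \<delta> cos_ge_zero[of \<delta>] by (simp add: abs_le_square_iff [symmetric])
    also have "\<dots> \<longleftrightarrow> t\<^sup>2 \<le> (sin \<delta>)\<^sup>2"
      using np sin_cos_squared_add[of \<delta>] by linarith
    also have "\<dots> \<longleftrightarrow> \<bar>t\<bar> \<le> sin \<delta>"
      using \<delta> sin_ge_zero[of \<delta>] by (simp add: abs_le_square_iff [symmetric])
    finally show ?thesis by (simp only: t_def)
  qed
  then show ?thesis unfolding sphere_neighborhood_def by auto
qed

section \<open>Area of the intersection of two bands\<close>

text \<open>By the mean value theorem, since the cosine is at least 1/2 up to \<open>pi / 3\<close>,
  which exceeds 1.\<close>

lemma half_le_sin: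
  fixes x :: real
  assumes "0 \<le> x" "x \<le> 1"
  shows "x / 2 \<le> sin x"
proof (cases "x = 0")
  case False
  with assms have "\<exists>t>0. t < x \<and> sin x - sin 0 = (x - 0) * cos t"
    by (intro MVT2) auto
  then obtain t where t: "0 < t" "t < x" "sin x = x * cos t" by auto
  have "cos (pi / 3) \<le> cos t"
    using t assms pi_gt3 by (intro cos_monotone_0_pi_le) auto
  then have "x * (1 / 2) \<le> x * cos t"
    using assms by (intro mult_left_mono) (auto simp: cos_60)
  with t show ?thesis by simp
qed simp

lemma compact_cone:
  fixes A :: "'a::real_normed_vector set"
  assumes "compact A"
  shows "compact {r *\<^sub>R x | r x. r \<in> {0..1::real} \<and> x \<in> A}"
proof -
  have "{r *\<^sub>R x | r x. r \<in> {0..1::real} \<and> x \<in> A} = (\<lambda>(r, x). r *\<^sub>R x) ` ({0..1} \<times> A)"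
    by force
  moreover have "compact \<dots>"
    using assms by (intro compact_continuous_image compact_Times)
      (auto simp: case_prod_unfold intro!: continuous_intros)
  ultimately show ?thesis by simp
qed

text \<open>\<open>S\<close> lies in the truncated cone over \<open>A\<close>. An area is thus
  bounded from below by the volume of any convenient solid that fits into the cone, and no surface
  integral is evaluated.\<close>

lemma measure_le_surface_area:
  assumes "compact A" "S \<in> lmeasurable" "S \<subseteq> cball 0 1"
    and "\<And>x. x \<in> S \<Longrightarrow> x \<noteq> 0 \<and> sgn x \<in> A"
  shows "3 * measure lebesgue S \<le> surface_area A"
proof -
  let ?C = "{r *\<^sub>R x | r x. r \<in> {0..1} \<and> x \<in> A}"
  have "S \<subseteq> ?C"
  proof
    fix x assume x: "x \<in> S"
    then have "x = norm x *\<^sub>R sgn x" "norm x \<in> {0..1}" "sgn x \<in> A"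
      using assms by (auto simp: sgn_div_norm)
    then show "x \<in> ?C" by blast
  qed
  then have "measure lebesgue S \<le> measure lebesgue ?C"
    using assms compact_cone[of A]
    by (intro measure_mono_fmeasurable) (auto intro: lmeasurable_compact fmeasurableD)
  then show ?thesis by (simp add: surface_area_def)
qed

text \<open>\<open>w\<close> is the direction of the component \<open>p\<close> of \<open>v\<close>
  orthogonal to \<open>u\<close>, or any unit vector orthogonal to \<open>u\<close> if
  \<open>p\<close> vanishes; the cross product \<open>e\<close> is then orthogonal to both
  \<open>u\<close> and \<open>v\<close>. The bound on \<open>\<beta>\<close> holds because
  \<open>p\<close> is also the component of \<open>v - u\<close> orthogonal to
  \<open>u\<close>.\<close>

lemma exists_orthonormal_frame:
  fixes u v :: "real^3"
  assumes u: "norm u = 1"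
  obtains e w \<alpha> \<beta> where "norm e = 1" "norm w = 1" "e \<bullet> u = 0" "e \<bullet> w = 0" "u \<bullet> w = 0"
    "v = \<alpha> *\<^sub>R u + \<beta> *\<^sub>R w" "\<bar>\<beta>\<bar> \<le> norm (u - v)"
proof -
  define p where "p = v - (u \<bullet> v) *\<^sub>R u"
  have uu: "u \<bullet> u = 1" using u by (simp add: norm_eq_1)
  have up: "u \<bullet> p = 0" by (simp add: p_def inner_diff uu)
  have "\<exists>w. norm w = 1 \<and> u \<bullet> w = 0 \<and> p = norm p *\<^sub>R w"
  proof (cases "p = 0")
    case True
    obtain y where "y \<noteq> 0" "orthogonal u y"
      using orthogonal_to_vector_exists[of u] by auto
    then show ?thesis using True
      by (intro exI[of _ "sgn y"]) (auto simp: orthogonal_def norm_sgn sgn_div_norm)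
  next
    case False
    then show ?thesis using up
      by (intro exI[of _ "sgn p"]) (auto simp: norm_sgn sgn_div_norm)
  qed
  then obtain w where w: "norm w = 1" "u \<bullet> w = 0" "p = norm p *\<^sub>R w" by blast
  define e where "e = cross3 u w"
  have e: "e \<bullet> u = 0" "e \<bullet> w = 0"
    by (simp_all add: e_def dot_cross_self)
  have "norm e ^ 2 = 1"
    using norm_cross_dot[of u w] w u by (simp add: e_def)
  then have "norm e = 1" by (simp add: power2_eq_1_iff) (use norm_ge_zero[of e] in linarith)
  moreover have "v = (u \<bullet> v) *\<^sub>R u + norm p *\<^sub>R w"
    using w(3) by (simp add: p_def)
  moreover have "\<bar>norm p\<bar> \<le> norm (u - v)"
  proof -
    have "(u - v) \<bullet> (u - v) = (u \<bullet> v - 1)\<^sup>2 + p \<bullet> p"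
      by (simp add: p_def inner_diff inner_commute uu power2_eq_square algebra_simps)
    then have "(norm p)\<^sup>2 \<le> (norm (u - v))\<^sup>2"
      by (simp add: power2_norm_eq_inner)
    then show ?thesis by simp
  qed
  ultimately show thesis using that e w by blast
qed

text \<open>The orthogonal transformation taking the standard basis to the frame maps an
  axis-parallel box with the same sides onto \<open>S\<close>.\<close>

lemma measure_orthonormal_box:
  fixes e u w :: "real^3"
  assumes n: "norm e = 1" "norm u = 1" "norm w = 1" "e \<bullet> u = 0" "e \<bullet> w = 0" "u \<bullet> w = 0"
    and le: "a0 \<le> a1" "b0 \<le> b1" "c0 \<le> c1"
  defines "S \<equiv> {a *\<^sub>R e + b *\<^sub>R u + c *\<^sub>R w | a b c. a \<in> {a0..a1} \<and> b \<in> {b0..b1} \<and> c \<in> {c0..c1}}"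
  shows "S \<in> lmeasurable" "measure lebesgue S = (a1 - a0) * (b1 - b0) * (c1 - c0)"
proof -
  define f where "f x = x $ 1 *\<^sub>R e + x $ 2 *\<^sub>R u + x $ 3 *\<^sub>R w" for x :: "real^3"
  define B where "B = cbox (vector [a0,b0,c0]) (vector [a1,b1,c1] :: real^3)"
  have nn: "e \<bullet> e = 1" "u \<bullet> u = 1" "w \<bullet> w = 1" "u \<bullet> e = 0" "w \<bullet> e = 0" "w \<bullet> u = 0"
    using n by (auto simp: norm_eq_1 inner_commute)
  have "linear f"
    by (rule linearI) (auto simp: f_def algebra_simps)
  moreover have "f x \<bullet> f y = x \<bullet> y" for x y
  proof -
    have "f x \<bullet> f y = x $ 1 * y $ 1 + x $ 2 * y $ 2 + x $ 3 * y $ 3"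
      by (simp add: f_def inner_add nn n)
    then show ?thesis by (simp add: inner_vec_def sum_3)
  qed
  ultimately have f: "orthogonal_transformation f"
    by (simp add: orthogonal_transformation_def)
  have "S = f ` B"
  proof safe
    fix x assume "x \<in> S"
    then obtain a b c where x: "x = a *\<^sub>R e + b *\<^sub>R u + c *\<^sub>R w"
       "a \<in> {a0..a1}" "b \<in> {b0..b1}" "c \<in> {c0..c1}" by (auto simp: S_def)
    then show "x \<in> f ` B"
      by (intro image_eqI[of _ _ "vector [a,b,c]"]) (auto simp: f_def B_def mem_box_cart forall_3)
  next
    fix x assume "x \<in> B"
    then show "f x \<in> S" unfolding S_def f_def B_def mem_box_cart forall_3 by auto
  qed
  moreover have "measure lebesgue B = (a1 - a0) * (b1 - b0) * (c1 - c0)"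
  proof -
    have ne: "B \<noteq> {}" using le unfolding B_def interval_ne_empty_cart by (simp add: forall_3)
    have "measure lborel B = (a1 - a0) * (b1 - b0) * (c1 - c0)"
      unfolding B_def content_cbox_cart[OF ne[unfolded B_def]] UNIV_3 by simp
    then show ?thesis by (simp add: B_def)
  qed
  ultimately show "S \<in> lmeasurable" "measure lebesgue S = (a1 - a0) * (b1 - b0) * (c1 - c0)"
    using f by (auto simp: measurable_orthogonal_image measure_orthogonal_image B_def)
qed

text \<open>A box aligned with the frame fits into the cone over the intersection. With
  \<open>M\<close> the maximum in the denominator, its volume is
  \<open>1/4 * (\<delta>/4) * (\<delta> / (4 * M))\<close>, and the factor 3 of
  \<open>surface_area\<close> gives 3/64.\<close>

lemma surface_area_band_Int_ge:
  fixes u v :: "real^3"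
  assumes u: "norm u = 1" and \<delta>: "0 < \<delta>" "\<delta> \<le> 1" and v: "norm v \<le> 1"
  shows "3 / 64 * (\<delta>\<^sup>2 / max (norm (u - v)) \<delta>)
    \<le> surface_area ({x \<in> sphere 0 1. \<bar>u \<bullet> x\<bar> \<le> sin \<delta>} \<inter> {x \<in> sphere 0 1. \<bar>v \<bullet> x\<bar> \<le> sin \<delta>})"
    (is "_ \<le> surface_area ?A")
proof -
  define M where "M = max (norm (u - v)) \<delta>"
  have M: "M > 0" "\<delta> \<le> M" "norm (u - v) \<le> M" using \<delta> by (auto simp: M_def)
  obtain e w \<alpha> \<beta> where fr: "norm e = 1" "norm w = 1" "e \<bullet> u = 0" "e \<bullet> w = 0" "u \<bullet> w = 0"
    "v = \<alpha> *\<^sub>R u + \<beta> *\<^sub>R w" "\<bar>\<beta>\<bar> \<le> norm (u - v)"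
    using exists_orthonormal_frame[OF u] by blast
  have nn: "e \<bullet> e = 1" "u \<bullet> u = 1" "w \<bullet> w = 1" "u \<bullet> e = 0" "w \<bullet> e = 0" "w \<bullet> u = 0"
    using fr u by (auto simp: norm_eq_1 inner_commute)
  have "\<alpha> = u \<bullet> v" by (simp add: fr inner_add nn)
  then have \<alpha>: "\<bar>\<alpha>\<bar> \<le> 1"
    using Cauchy_Schwarz_ineq2[of u v] u v by simp
  \<comment> \<open>\<open>e\<close> points towards a crossing of the two circles; the patch has extent about \<open>\<delta>\<close> along
    \<open>u\<close> and about \<open>\<delta> / M\<close> along \<open>w\<close>.\<close>
  define h where "h = \<delta> / (8 * M)"
  have h: "0 < h" "h \<le> 1 / 8" "M * h = \<delta> / 8" using M \<delta> by (auto simp: h_def field_simps)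
  \<comment> \<open>The range of \<open>a\<close> and the bound 1/8 on the other two coordinates
    keep the norm between 1/2 and 1.\<close>
  let ?S = "{a *\<^sub>R e + b *\<^sub>R u + c *\<^sub>R w | a b c.
    a \<in> {1/2..3/4} \<and> b \<in> {- (\<delta>/8)..\<delta>/8} \<and> c \<in> {- h..h}}"
  have S: "?S \<in> lmeasurable" "measure lebesgue ?S = (3/4 - 1/2) * (\<delta>/8 - - (\<delta>/8)) * (h - - h)"
    using \<delta> h by (intro measure_orthonormal_box fr u; simp)+
  have inS: "x \<in> cball 0 1 \<and> x \<noteq> 0 \<and> sgn x \<in> ?A" if "x \<in> ?S" for x
  proof -
    obtain a b c where x: "x = a *\<^sub>R e + b *\<^sub>R u + c *\<^sub>R w"
      and a: "1/2 \<le> a" "a \<le> 3/4" and b: "\<bar>b\<bar> \<le> \<delta>/8" and c: "\<bar>c\<bar> \<le> h"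
      using \<open>x \<in> ?S\<close> by (auto simp: abs_le_iff)
    have nx: "(norm x)\<^sup>2 = a\<^sup>2 + b\<^sup>2 + c\<^sup>2"
      unfolding power2_norm_eq_inner x by (simp add: inner_add nn fr power2_eq_square algebra_simps)
    have "a\<^sup>2 \<le> (3/4)\<^sup>2" using a by (intro power_mono) auto
    moreover have "\<bar>b\<bar>\<^sup>2 \<le> (1/8)\<^sup>2" using b \<delta> by (intro power_mono) auto
    moreover have "\<bar>c\<bar>\<^sup>2 \<le> (1/8)\<^sup>2" using c h by (intro power_mono) auto
    ultimately have "(norm x)\<^sup>2 \<le> 1\<^sup>2" unfolding nx by (simp add: power2_eq_square)
    then have le1: "norm x \<le> 1" by (rule power2_le_imp_le) simp
    have "(1/2)\<^sup>2 \<le> a\<^sup>2" using a by (intro power_mono) auto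
    moreover have "0 \<le> b\<^sup>2" "0 \<le> c\<^sup>2" by simp_all
    ultimately have "(1/2)\<^sup>2 \<le> (norm x)\<^sup>2" unfolding nx by linarith
    then have ge: "1/2 \<le> norm x" by (rule power2_le_imp_le) simp
    \<comment> \<open>Projecting to the sphere at most doubles the inner product, as the norm is at
      least 1/2; the result \<open>\<delta> / 2\<close> is still at most
      \<open>sin \<delta>\<close>.\<close>
    have bound: "\<bar>z \<bullet> sgn x\<bar> \<le> sin \<delta>" if "\<bar>z \<bullet> x\<bar> \<le> \<delta> / 4" for z
    proof -
      have "\<bar>z \<bullet> sgn x\<bar> = \<bar>z \<bullet> x\<bar> / norm x"
        by (simp add: sgn_div_norm abs_mult divide_inverse_commute)
      also have "\<dots> \<le> (\<delta> / 4) / (1 / 2)"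
        using that ge \<delta> by (intro frac_le) auto
      also have "\<dots> \<le> sin \<delta>" using half_le_sin[of \<delta>] \<delta> by simp
      finally show ?thesis .
    qed
    have "u \<bullet> x = b" by (simp add: x inner_add nn fr)
    then have ux: "\<bar>u \<bullet> x\<bar> \<le> \<delta> / 4" using b \<delta> by simp
    have "v \<bullet> x = \<alpha> * b + \<beta> * c"
      by (simp add: x fr(6) inner_add nn fr(1-5))
    also have "\<bar>\<dots>\<bar> \<le> \<bar>\<alpha>\<bar> * \<bar>b\<bar> + \<bar>\<beta>\<bar> * \<bar>c\<bar>"
      by (metis abs_mult abs_triangle_ineq)
    \<comment> \<open>The choice of \<open>h\<close> makes both terms at most
      \<open>\<delta> / 8\<close>.\<close>
    also have "\<dots> \<le> 1 * (\<delta>/8) + M * h"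
      using \<alpha> b fr(7) c M by (intro add_mono mult_mono) auto
    finally have vx: "\<bar>v \<bullet> x\<bar> \<le> \<delta> / 4" using h by simp
    show ?thesis
      using le1 ge bound[OF ux] bound[OF vx] by (auto simp: norm_sgn)
  qed
  have "compact ?A"
  proof -
    have "?A = sphere 0 1 \<inter> ({x. \<bar>u \<bullet> x\<bar> \<le> sin \<delta>} \<inter> {x. \<bar>v \<bullet> x\<bar> \<le> sin \<delta>})" by auto
    moreover have "compact \<dots>"
      by (intro compact_Int_closed closed_Int closed_Collect_le continuous_intros) auto
    ultimately show ?thesis by simp
  qed
  from measure_le_surface_area[OF this S(1)] inS
  have "3 * measure lebesgue ?S \<le> surface_area ?A" by blast
  then show ?thesis unfolding S(2) M_def[symmetric] using M
    by (simp add: h_def power2_eq_square field_simps)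
qed

text \<open>Rescaling the normals to unit length keeps the planes and does not increase the distance
  of the normals, so the bound for unit normals is at least as strong.\<close>

lemma surface_area_neighborhood_Int_ge:
  fixes v w :: "real^3"
  assumes "normalized_normal v" "normalized_normal w" "0 < \<delta>" "\<delta> \<le> 1"
  shows "3 / 64 * (\<delta>\<^sup>2 / max (norm (v - w)) \<delta>)
    \<le> surface_area (sphere_neighborhood \<delta> (sphere 0 1 \<inter> {x. v \<bullet> x = 0}) \<inter>
                    sphere_neighborhood \<delta> (sphere 0 1 \<inter> {x. w \<bullet> x = 0}))"
proof -
  have ge1: "norm v \<ge> 1" "norm w \<ge> 1"
    using assms norm_ge_1_if_normalized_normal by auto
  then have n: "norm (sgn v) = 1" "norm (sgn w) = 1" by (auto simp: norm_sgn)
  have eq: "{x. z \<bullet> x = 0} = {x. sgn z \<bullet> x = 0}" for z :: "real^3"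
    by (auto simp: sgn_div_norm)
  have pi: "\<delta> < pi / 2" using assms pi_gt3 by linarith
  have "3 / 64 * (\<delta>\<^sup>2 / max (norm (v - w)) \<delta>) \<le> 3 / 64 * (\<delta>\<^sup>2 / max (norm (sgn v - sgn w)) \<delta>)"
    using norm_sgn_diff_le[OF ge1] assms by (intro mult_left_mono divide_left_mono) auto
  also have "\<dots> \<le> surface_area ({x \<in> sphere 0 1. \<bar>sgn v \<bullet> x\<bar> \<le> sin \<delta>} \<inter>
      {x \<in> sphere 0 1. \<bar>sgn w \<bullet> x\<bar> \<le> sin \<delta>})"
    using assms n by (intro surface_area_band_Int_ge) auto
  finally show ?thesis
    unfolding eq[of v] eq[of w] using sphere_neighborhood_eq_band n assms pi by simp
qed

section \<open>Close pairs and energy bounds\<close>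

definition pairs :: "nat \<Rightarrow> (nat \<times> nat) set" where
  "pairs n = {(i, j). i \<in> {1..n} \<and> j \<in> {1..n} \<and> i \<noteq> j}"

definition close_pairs :: "(nat \<Rightarrow> real^3) \<Rightarrow> nat \<Rightarrow> real \<Rightarrow> (nat \<times> nat) set" where
  "close_pairs w n r = {(i, j) \<in> pairs n. norm (w i - w j) \<le> r}"

text \<open>Up to a constant factor, the summand bounds the area of the intersection of the two strips
  from below.\<close>

definition energy :: "(nat \<Rightarrow> real^3) \<Rightarrow> nat \<Rightarrow> real \<Rightarrow> real" where
  "energy w n s =
    (\<Sum>(i, j)\<in>pairs n. ((1 / real n)\<^sup>2 / max (norm (w i - w j)) (1 / real n)) powr s)"

lemma finite_pairs [simp]: "finite (pairs n)"
  by (rule finite_subset[of _ "{1..n} \<times> {1..n}"]) (auto simp: pairs_def)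

lemma close_pairs_subset: "close_pairs w n r \<subseteq> pairs n"
  by (auto simp: close_pairs_def)

lemma card_pairs_ge:
  assumes "n \<ge> 2"
  shows "real n ^ 2 / 2 \<le> card (pairs n)"
proof -
  have "pairs n \<union> Id_on {1..n} = {1..n} \<times> {1..n}" "pairs n \<inter> Id_on {1..n} = {}"
    by (auto simp: pairs_def Id_on_def)
  moreover have "card (Id_on {1..n}) = n"
    unfolding Id_on_def by (subst UNION_singleton_eq_range) (simp add: card_image inj_on_def)
  moreover have "finite (Id_on {1..n})"
    by (rule finite_subset[of _ "{1..n} \<times> {1..n}"]) auto
  ultimately have "card (pairs n) + n = n * n"
    by (metis card_Un_disjoint finite_pairs card_cartesian_product card_atLeastAtMost diff_Suc_1 Suc_eq_plus1)
  then have "real (card (pairs n)) + real n = real n * real n"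
    by (metis of_nat_add of_nat_mult)
  moreover have "2 * real n \<le> real n * real n"
    using assms by (intro mult_right_mono) auto
  ultimately show ?thesis by (simp add: power2_eq_square)
qed

text \<open>The cell count with \<open>m = 2 ^ k\<close>. The condition on \<open>n\<close>, with 54
  twice 27, bounds the diagonal term by half of \<open>n^2\<close>, so it can be absorbed.\<close>

lemma card_close_pairs_ge:
  assumes w: "\<And>i. i \<in> {1..n} \<Longrightarrow> normalized_normal (w i)" and n: "54 * 4 ^ k \<le> n"
  shows "real n ^ 2 / (54 * 4 ^ k) \<le> card (close_pairs w n (3 / 2 ^ k))"
proof -
  have "close_pairs w n (3 / 2 ^ k)
    = {(i, j). i \<in> {1..n} \<and> j \<in> {1..n} \<and> i \<noteq> j \<and> norm (w i - w j) \<le> 3 / real (2 ^ k)}"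
    by (auto simp: close_pairs_def pairs_def)
  moreover have "(real (2 ^ k))\<^sup>2 = 4 ^ k"
    by (simp add: power2_eq_square flip: power_mult_distrib)
  ultimately have *: "real n ^ 2 \<le> 27 * 4 ^ k * (real (card (close_pairs w n (3 / 2 ^ k))) + real n)"
    using card_close_normals[of "{1..n}" "2 ^ k" w] w by simp
  have "real (54 * 4 ^ k) \<le> real n" using n by (simp only: of_nat_le_iff)
  then have "54 * 4 ^ k * real n \<le> real n * real n"
    by (intro mult_right_mono) auto
  with * have "real n ^ 2 \<le> 54 * 4 ^ k * real (card (close_pairs w n (3 / 2 ^ k)))"
    by (simp add: power2_eq_square algebra_simps)
  then show ?thesis by (simp add: field_simps)
qed

text \<open>Normalized normals have norm at most 3, hence distance at most 6, so each of the at
  least \<open>n^2 / 2\<close> summands is at least the power of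
  \<open>(1 / n)^2 / 6\<close>.\<close>

lemma energy_ge_trivial:
  assumes w: "\<And>i. i \<in> {1..n} \<Longrightarrow> normalized_normal (w i)" and n: "n \<ge> 2" and s: "s \<ge> 0"
  shows "(1 / 6) powr s / 2 * real n powr (2 - 2 * s) \<le> energy w n s"
proof -
  have bd: "norm (w i) \<le> 3" if "i \<in> {1..n}" for i
  proof -
    have "(\<Sum>k\<in>UNIV. \<bar>w i $ k\<bar>) \<le> (\<Sum>k\<in>(UNIV::3 set). 1)"
      using w[OF that] by (intro sum_mono) (auto simp: normalized_normal_def)
    then show ?thesis using norm_le_l1_cart[of "w i"] by simp
  qed
  have "(1 / 6) powr s / 2 * real n powr (2 - 2 * s) = real n ^ 2 / 2 * ((1 / real n)\<^sup>2 / 6) powr s"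
  proof -
    have "(1 / real n)\<^sup>2 = real n powr (- 2)"
      using n by (simp add: powr_minus_divide power_divide)
    then have "((1 / real n)\<^sup>2 / 6) powr s = (real n powr (- 2) * (1 / 6)) powr s" by simp
    also have "\<dots> = real n powr (- 2 * s) * (1 / 6) powr s"
      by (simp only: powr_mult powr_powr)
    moreover have "real n powr (2 - 2 * s) = real n ^ 2 * real n powr (- 2 * s)"
      using n by (simp add: powr_diff powr_minus_divide)
    ultimately show ?thesis by simp
  qed
  also have "\<dots> \<le> card (pairs n) * ((1 / real n)\<^sup>2 / 6) powr s"
    by (intro mult_right_mono card_pairs_ge n) auto
  also have "\<dots> = (\<Sum>(i, j)\<in>pairs n. ((1 / real n)\<^sup>2 / 6) powr s)" by simp
  also have "\<dots> \<le> energy w n s"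
    unfolding energy_def
  proof (intro sum_mono, clarify)
    fix i j assume ij: "(i, j) \<in> pairs n"
    then have "norm (w i - w j) \<le> 3 + 3"
      using bd[of i] bd[of j] norm_triangle_ineq4[of "w i" "w j"] by (auto simp: pairs_def)
    moreover have "1 / real n \<le> 1" using n by simp
    ultimately have "max (norm (w i - w j)) (1 / real n) \<le> 6" by linarith
    moreover have "max (norm (w i - w j)) (1 / real n) > 0" using n by (simp add: less_max_iff_disj)
    ultimately show "((1 / real n)\<^sup>2 / 6) powr s
        \<le> ((1 / real n)\<^sup>2 / max (norm (w i - w j)) (1 / real n)) powr s"
      using s by (intro powr_mono2 divide_left_mono) auto
  qed
  finally show ?thesis .
qed

text \<open>\<open>K\<close> is the finest scale at which \<open>card_close_pairs_ge\<close>
  applies; \<open>4 ^ K\<close> is then comparable to \<open>n\<close>.\<close>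

lemma obtain_scale:
  fixes n :: nat
  assumes "n \<ge> 54"
  obtains K where "54 * 4 ^ K \<le> n" "n < 216 * 4 ^ K"
proof -
  obtain K where K: "4 ^ K \<le> n div 54" "n div 54 < 4 ^ (K + 1)"
    using ex_power_ivl1[of 4 "n div 54"] div_le_mono[OF assms, of 54] by auto
  then show thesis
    using that[of K] by (simp add: less_eq_div_iff_mult_less_eq div_less_iff_less_mult mult.commute)
qed

text \<open>At the finest scale there are at least \<open>n\<close> close pairs, at distance at most
  \<open>48 / sqrt n\<close>, and each contributes at least the power of
  \<open>n powr (- 3 / 2) / 48\<close>. Below 54 the trivial bound suffices.\<close>

lemma energy_ge_single_scale:
  assumes w: "\<And>i. i \<in> {1..n} \<Longrightarrow> normalized_normal (w i)" and n: "n \<ge> 2" and s: "s \<ge> 0"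
  shows "(1 / 48) powr s / 2 * real n powr (1 - 3 * s / 2) \<le> energy w n s"
proof (cases "n \<ge> 54")
  case False
  \<comment> \<open>Here 64 is a convenient square above \<open>n\<close>; the resulting 1/8 times
    the 1/6 of the trivial bound gives 1/48.\<close>
  have "real n powr (- (s / 2)) \<ge> 64 powr (- (s / 2))"
    using False n s by (intro powr_mono2') auto
  also have "64 powr (- (s / 2)) = (1 / 8) powr s"
  proof -
    have "(64::real) = 8 powr 2" by simp
    then have "(64::real) powr (- (s / 2)) = 8 powr (- s)"
      by (simp only: powr_powr) simp
    then show ?thesis by (simp add: powr_minus_divide powr_divide)
  qed
  finally have le: "(1 / 8) powr s \<le> real n powr (- (s / 2))" .
  have "(1 / 48) powr s / 2 * real n powr (1 - 3 * s / 2)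
      = (1 / 6) powr s / 2 * real n powr (1 - 3 * s / 2) * (1 / 8) powr s"
    by (simp flip: powr_mult)
  also have "\<dots> \<le> (1 / 6) powr s / 2 * real n powr (1 - 3 * s / 2) * real n powr (- (s / 2))"
    using le by (intro mult_left_mono) auto
  also have "\<dots> = (1 / 6) powr s / 2 * real n powr (1 - 2 * s)"
    by (simp flip: powr_add)
  also have "\<dots> \<le> (1 / 6) powr s / 2 * real n powr (2 - 2 * s)"
    using n by (intro mult_left_mono powr_mono) auto
  also have "\<dots> \<le> energy w n s" by (rule energy_ge_trivial[OF w n s])
  finally show ?thesis .
next
  case True
  then obtain K where K: "54 * 4 ^ K \<le> n" "n < 216 * 4 ^ K" by (rule obtain_scale)
  have n0: "real n > 0" using n by simp
  \<comment> \<open>15 is the root of 225, just above 216. Rounding it up to 16 below gives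
    \<open>3 * 16 = 48\<close>, the constant of the case of small \<open>n\<close>.\<close>
  have sq: "sqrt n \<le> 15 * 2 ^ K"
  proof (rule real_le_lsqrt)
    have "real n \<le> real (216 * 4 ^ K)" using K(2) by (simp only: of_nat_le_iff)
    also have "\<dots> \<le> 225 * 4 ^ K" by simp
    also have "\<dots> = (15 * 2 ^ K)\<^sup>2" by (simp add: power_mult_distrib power2_eq_square flip: power_mult_distrib)
    finally show "real n \<le> (15 * 2 ^ K)\<^sup>2" .
  qed auto
  let ?C = "close_pairs w n (3 / 2 ^ K)"
  have "real (54 * 4 ^ K) \<le> real n" using K(1) by (simp only: of_nat_le_iff)
  then have "real n * (54 * 4 ^ K) \<le> real n * real n"
    by (intro mult_left_mono) auto
  then have "real n \<le> real n ^ 2 / (54 * 4 ^ K)" by (simp add: field_simps power2_eq_square)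
  also have "\<dots> \<le> card ?C" by (rule card_close_pairs_ge[OF w K(1)])
  finally have card: "real n \<le> card ?C" .
  have "(1 / 48) powr s / 2 * real n powr (1 - 3 * s / 2)
      = real n * (1 / 48 * real n powr (- 3 / 2)) powr s / 2"
  proof -
    have "real n powr (1 - 3 * s / 2) = real n powr 1 * real n powr (- 3 / 2 * s)"
      by (simp only: powr_add [symmetric]) (simp add: field_simps)
    moreover have "(1 / 48 * real n powr (- 3 / 2)) powr s = (1 / 48) powr s * real n powr (- 3 / 2 * s)"
      by (simp only: powr_mult powr_powr)
    ultimately show ?thesis using n0 by simp
  qed
  also have "\<dots> \<le> real n * (1 / 48 * real n powr (- 3 / 2)) powr s"
    using n0 by simp
  also have "\<dots> \<le> card ?C * (1 / 48 * real n powr (- 3 / 2)) powr s"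
    using card by (intro mult_right_mono) auto
  also have "\<dots> = (\<Sum>(i, j)\<in>?C. (1 / 48 * real n powr (- 3 / 2)) powr s)" by simp
  also have "\<dots> \<le> (\<Sum>(i, j)\<in>?C. ((1 / real n)\<^sup>2 / max (norm (w i - w j)) (1 / real n)) powr s)"
  proof (intro sum_mono, clarify)
    fix i j assume "(i, j) \<in> ?C"
    then have "norm (w i - w j) \<le> 3 / 2 ^ K" by (auto simp: close_pairs_def)
    also have "\<dots> \<le> 48 / sqrt n"
    proof -
      have "sqrt n \<le> 16 * 2 ^ K" using sq by (rule order_trans) simp
      then show ?thesis using n0 by (simp add: field_simps)
    qed
    finally have 1: "norm (w i - w j) \<le> 48 / sqrt n" .
    have "sqrt n \<le> real n" using n by (intro real_le_lsqrt) (auto simp: power2_eq_square)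
    then have "sqrt n \<le> 48 * real n" using n0 by linarith
    then have "1 / real n \<le> 48 / sqrt n" using n0 by (simp add: field_simps)
    with 1 have "max (norm (w i - w j)) (1 / real n) \<le> 48 / sqrt n" by simp
    moreover have "max (norm (w i - w j)) (1 / real n) > 0" using n by (simp add: less_max_iff_disj)
    ultimately have "(1 / real n)\<^sup>2 / (48 / sqrt n) \<le> (1 / real n)\<^sup>2 / max (norm (w i - w j)) (1 / real n)"
      using n0 by (intro divide_left_mono) auto
    also have "(1 / real n)\<^sup>2 / (48 / sqrt n) = 1 / 48 * real n powr (- 3 / 2)"
    proof -
      have "real n powr (- 3 / 2) = real n powr (1 / 2 - 2)" by simp
      also have "\<dots> = sqrt n / real n ^ 2"
        using n0 by (simp only: powr_diff powr_half_sqrt powr_numeral)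
      finally show ?thesis by (simp add: power_divide)
    qed
    finally show "(1 / 48 * real n powr (- 3 / 2)) powr s
      \<le> ((1 / real n)\<^sup>2 / max (norm (w i - w j)) (1 / real n)) powr s"
      using s by (intro powr_mono2) auto
  qed
  also have "\<dots> \<le> energy w n s"
    unfolding energy_def by (rule sum_mono2) (use close_pairs_subset in auto)
  finally show ?thesis .
qed

text \<open>A geometric sum is dominated by its largest term. Below, this bounds the total weight
  that one pair collects from all scales at which it is close.\<close>

lemma sum_powers_of_4_le:
  fixes B :: real
  assumes "finite A" "B \<ge> 0" and le: "\<And>k. k \<in> A \<Longrightarrow> 4 ^ k \<le> B"
  shows "(\<Sum>k\<in>A. 4 ^ k) \<le> 4 / 3 * B"
proof (cases "A = {}")
  case False
  define m where "m = Max A"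
  have "A \<subseteq> {..<Suc m}" using assms(1) by (auto simp: m_def less_Suc_eq_le)
  then have "(\<Sum>k\<in>A. (4::real) ^ k) \<le> (\<Sum>k<Suc m. 4 ^ k)"
    by (intro sum_mono2) auto
  also have "\<dots> = (4 ^ Suc m - 1) / 3"
    by (subst geometric_sum) auto
  also have "\<dots> \<le> 4 / 3 * 4 ^ m" by simp
  also have "\<dots> \<le> 4 / 3 * B"
    using le[of m] Max_in[OF assms(1) False] by (simp add: m_def)
  finally show ?thesis .
qed (use assms in simp)

text \<open>Double counting with weight \<open>4 ^ k\<close> at scale \<open>k\<close>: each of the
  \<open>K + 1\<close> scales contributes at least \<open>n^2 / 54\<close>, while a pair at cut-off
  distance \<open>d\<close> collects at most \<open>12 / d^2\<close>, which is
  \<open>12 * n^4\<close> times its energy summand. Since \<open>ln n\<close> is at most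
  \<open>8 * (K + 1)\<close>, the constant is \<open>8 * 54 * 12 = 5184\<close>.\<close>

lemma energy_2_ge:
  assumes w: "\<And>i. i \<in> {1..n} \<Longrightarrow> normalized_normal (w i)" and n: "n \<ge> 2"
  shows "1 / 5184 * (real n powr (- 2) * ln (real n)) \<le> energy w n 2"
proof (cases "n \<ge> 54")
  case False
  have "ln (real n) \<le> ln (2 ^ 6)"
    using False n by (subst ln_le_cancel_iff) auto
  also have "\<dots> = 6 * ln 2" by (subst ln_realpow) auto
  also have "\<dots> \<le> 6" using ln_2_less_1 by simp
  finally have "1 / 5184 * (real n powr (- 2) * ln (real n)) \<le> 1 / 5184 * (real n powr (- 2) * 6)"
    by (intro mult_left_mono) auto
  also have "\<dots> \<le> 1 / 72 * real n powr (- 2)" by simp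
  also have "\<dots> \<le> energy w n 2"
    using energy_ge_trivial[OF w n, where s = 2] by (simp add: power2_eq_square)
  finally show ?thesis .
next
  case True
  then obtain K where K: "54 * 4 ^ K \<le> n" "n < 216 * 4 ^ K" by (rule obtain_scale)
  have n0: "real n > 0" using n by simp
  define d where "d = (\<lambda>(i, j). max (norm (w i - w j)) (1 / real n))"
  have d0: "d p > 0" for p using n0 by (simp add: d_def less_max_iff_disj split: prod.splits)
  have ln_le: "ln (real n) \<le> 8 * (real K + 1)"
  proof -
    have "real n \<le> real (216 * 4 ^ K)" using K(2) by (simp only: of_nat_le_iff)
    \<comment> \<open>216 is rounded up to 256.\<close>
    also have "\<dots> \<le> 2 ^ (8 + 2 * K)"
      by (simp add: power_add power_mult)
    finally have "ln (real n) \<le> ln (2 ^ (8 + 2 * K))" using n0 by (subst ln_le_cancel_iff) auto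
    also have "\<dots> = (8 + 2 * real K) * ln 2" by (subst ln_realpow) auto
    also have "\<dots> \<le> (8 + 2 * real K) * 1"
      using ln_2_less_1 by (intro mult_left_mono) auto
    finally show ?thesis by simp
  qed
  have "(real K + 1) * (real n ^ 2 / 54) = (\<Sum>k\<le>K. 4 ^ k * (real n ^ 2 / (54 * 4 ^ k)))"
    by simp
  also have "\<dots> \<le> (\<Sum>k\<le>K. 4 ^ k * real (card (close_pairs w n (3 / 2 ^ k))))"
  proof (intro sum_mono mult_left_mono card_close_pairs_ge w)
    fix k assume "k \<in> {..K}"
    then have "(4::nat) ^ k \<le> 4 ^ K" by (intro power_increasing) auto
    then show "54 * 4 ^ k \<le> n" using K(1) by linarith
  qed auto
  also have "\<dots> = (\<Sum>k\<le>K. \<Sum>p\<in>pairs n. if p \<in> close_pairs w n (3 / 2 ^ k) then 4 ^ k else 0)"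
    by (intro sum.cong refl)
       (simp add: Int_absorb1 close_pairs_subset flip: sum.inter_restrict)
  \<comment> \<open>From here on the weights are collected pair by pair instead of scale by
    scale.\<close>
  also have "\<dots> = (\<Sum>p\<in>pairs n. \<Sum>k\<le>K. if p \<in> close_pairs w n (3 / 2 ^ k) then 4 ^ k else 0)"
    by (rule sum.swap)
  also have "\<dots> \<le> (\<Sum>p\<in>pairs n. 12 / (d p)\<^sup>2)"
  proof (rule sum_mono)
    fix p assume "p \<in> pairs n"
    obtain i j where p: "p = (i, j)" by fastforce
    have "(4::real) ^ k \<le> 9 / (d p)\<^sup>2" if k: "k \<le> K" "p \<in> close_pairs w n (3 / 2 ^ k)" for k
    proof -
      \<comment> \<open>At every scale up to \<open>K\<close> the radius \<open>3 / 2 ^ k\<close> is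
        at least the cutoff \<open>1 / n\<close>, so closeness bounds \<open>d p\<close> and not
        only the distance.\<close>
      have "(2::nat) ^ k \<le> 4 ^ k" by (intro power_mono) auto
      also have "(4::nat) ^ k \<le> 4 ^ K" using k by (intro power_increasing) auto
      also have "\<dots> \<le> n" using K(1) by linarith
      finally have "real (2 ^ k) \<le> real n" by (simp only: of_nat_le_iff)
      then have "2 ^ k \<le> real n" by (simp only: of_nat_power of_nat_numeral)
      then have "2 ^ k \<le> real n * 3" using n0 by linarith
      then have "1 / real n \<le> 3 / 2 ^ k" using n0 by (simp add: field_simps)
      with k have "d p \<le> 3 / 2 ^ k" by (auto simp: d_def p close_pairs_def)
      then have "2 ^ k * d p \<le> 3" by (simp add: field_simps)
      then have "(2 ^ k * d p)\<^sup>2 \<le> 3\<^sup>2" using d0[of p] by (intro power_mono) auto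
      then have "4 ^ k * (d p)\<^sup>2 \<le> 9" by (simp add: power2_eq_square algebra_simps flip: power_mult_distrib)
      then show ?thesis using d0[of p] by (simp add: field_simps)
    qed
    then have "(\<Sum>k\<in>{k \<in> {..K}. p \<in> close_pairs w n (3 / 2 ^ k)}. 4 ^ k) \<le> 4 / 3 * (9 / (d p)\<^sup>2)"
      by (intro sum_powers_of_4_le) auto
    then show "(\<Sum>k\<le>K. if p \<in> close_pairs w n (3 / 2 ^ k) then 4 ^ k else 0) \<le> 12 / (d p)\<^sup>2"
      by (subst sum.inter_filter [symmetric]) auto
  qed
  also have "\<dots> = 12 * real n ^ 4 * energy w n 2"
    unfolding energy_def sum_distrib_left
  proof (intro sum.cong refl, clarify)
    fix i j
    have "0 \<le> (1 / real n)\<^sup>2 / max (norm (w i - w j)) (1 / real n)" by (simp add: le_max_iff_disj)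
    then show "12 / (d (i, j))\<^sup>2
      = 12 * real n ^ 4 * ((1 / real n)\<^sup>2 / max (norm (w i - w j)) (1 / real n)) powr 2"
      using n0 by (simp add: d_def power_divide power_mult_distrib flip: power_mult)
  qed
  finally have *: "(real K + 1) * (real n ^ 2 / 54) \<le> 12 * real n ^ 4 * energy w n 2" .
  have "1 / 5184 * (real n powr (- 2) * ln (real n)) \<le> 1 / 5184 * (real n powr (- 2) * (8 * (real K + 1)))"
    using ln_le by (intro mult_left_mono) auto
  also have "\<dots> = (real K + 1) * (real n ^ 2 / 54) / (12 * real n ^ 4)"
    using n0 by (simp add: powr_minus_divide field_simps power2_eq_square power4_eq_xxxx)
  also have "\<dots> \<le> energy w n 2" using * n0 by (simp add: field_simps)
  finally show ?thesis .
qed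

section \<open>From the energy to the sum of areas\<close>

lemma great_circles_sum_ge_energy:
  assumes s: "s \<ge> 0" and n: "n \<ge> 2"
    and w: "\<And>i. i \<in> {1..n} \<Longrightarrow> normalized_normal (w i)"
    and \<Gamma>: "\<And>i. i \<in> {1..n} \<Longrightarrow> \<Gamma> i = sphere 0 1 \<inter> {x. w i \<bullet> x = 0}"
  shows "(3 / 64) powr s * energy w n s
    \<le> (\<Sum>(i, j)\<in>pairs n. surface_area (sphere_neighborhood (1 / real n) (\<Gamma> i) \<inter>
                            sphere_neighborhood (1 / real n) (\<Gamma> j)) powr s)"
  unfolding energy_def sum_distrib_left
proof (intro sum_mono, clarify)
  fix i j assume "(i, j) \<in> pairs n"
  then have ij: "i \<in> {1..n}" "j \<in> {1..n}" by (auto simp: pairs_def)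
  let ?X = "(1 / real n)\<^sup>2 / max (norm (w i - w j)) (1 / real n)"
  have X: "0 \<le> ?X" by (simp add: le_max_iff_disj)
  have "(3 / 64) powr s * ?X powr s = (3 / 64 * ?X) powr s"
    using X by (subst powr_mult) auto
  also have "\<dots> \<le> surface_area (sphere_neighborhood (1 / real n) (\<Gamma> i) \<inter>
                            sphere_neighborhood (1 / real n) (\<Gamma> j)) powr s"
    unfolding \<Gamma>[OF ij(1)] \<Gamma>[OF ij(2)]
    using s X n w ij by (intro powr_mono2 surface_area_neighborhood_Int_ge) auto
  finally show "(3 / 64) powr s * ?X powr s
    \<le> surface_area (sphere_neighborhood (1 / real n) (\<Gamma> i) \<inter>
                            sphere_neighborhood (1 / real n) (\<Gamma> j)) powr s" .
qed

theorem mainTheorem1: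
  fixes s :: real
  assumes "s \<ge> 0"
  shows "\<exists>c>0. \<forall>n::nat. n \<ge> 2 \<longrightarrow> (\<forall>\<Gamma> :: nat \<Rightarrow> (real ^ 3) set.
           (\<forall>i\<in>{1..n}. great_circle (\<Gamma> i)) \<and> inj_on \<Gamma> {1..n} \<longrightarrow>
           (\<Sum>(i, j)\<in>{(i, j). i \<in> {1..n} \<and> j \<in> {1..n} \<and> i \<noteq> j}.
              surface_area (sphere_neighborhood (1 / real n) (\<Gamma> i) \<inter>
                            sphere_neighborhood (1 / real n) (\<Gamma> j)) powr s)
           \<ge> c * (if s < 2 then real n powr (2 - 2 * s)
                  else if s = 2 then real n powr (-2) * ln (real n)
                  else real n powr (1 - 3 * s / 2)))"
proof -
  \<comment> \<open>The constants of the three energy bounds; like the factor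
    \<open>(3 / 64) powr s\<close> from the areas, they depend on \<open>s\<close> only.\<close>
  define c where "c = (if s < 2 then (1 / 6) powr s / 2 else if s = 2 then 1 / 5184 else (1 / 48) powr s / 2)"
  show ?thesis
  proof (intro exI[of _ "(3 / 64) powr s * c"] conjI allI impI)
    fix n :: nat and \<Gamma> :: "nat \<Rightarrow> (real ^ 3) set"
    assume n: "n \<ge> 2" and "(\<forall>i\<in>{1..n}. great_circle (\<Gamma> i)) \<and> inj_on \<Gamma> {1..n}"
    then have "\<forall>i\<in>{1..n}. \<exists>w. normalized_normal w \<and> \<Gamma> i = sphere 0 1 \<inter> {x. w \<bullet> x = 0}"
      by (metis great_circle_normal)
    then obtain w where w: "\<And>i. i \<in> {1..n} \<Longrightarrow> normalized_normal (w i)"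
      "\<And>i. i \<in> {1..n} \<Longrightarrow> \<Gamma> i = sphere 0 1 \<inter> {x. w i \<bullet> x = 0}"
      by metis
    let ?R = "if s < 2 then real n powr (2 - 2 * s)
                  else if s = 2 then real n powr (-2) * ln (real n)
                  else real n powr (1 - 3 * s / 2)"
    have "c * ?R \<le> energy w n s"
      using energy_ge_trivial[OF w(1) n assms] energy_2_ge[OF w(1) n]
        energy_ge_single_scale[OF w(1) n assms] by (auto simp: c_def)
    then have "(3 / 64) powr s * c * ?R \<le> (3 / 64) powr s * energy w n s"
      unfolding mult.assoc by (rule mult_left_mono) simp
    also note great_circles_sum_ge_energy[OF assms n w]
    finally show "(\<Sum>(i, j)\<in>{(i, j). i \<in> {1..n} \<and> j \<in> {1..n} \<and> i \<noteq> j}.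
              surface_area (sphere_neighborhood (1 / real n) (\<Gamma> i) \<inter>
                            sphere_neighborhood (1 / real n) (\<Gamma> j)) powr s)
           \<ge> (3 / 64) powr s * c * ?R"
      unfolding pairs_def .
  qed (simp add: c_def)
qed

end
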